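(* The class of $(\overline{P_1+P_4},\,P_1+2P_2)$-free graphs is not well-quasi-ordered by the induced subgraph relation.
   Context: Graphs are finite, undirected and simple. $P_r$ is the path on $r$ vertices, $G+H$ is the disjoint union of vertex-disjoint graphs $G,H$, $rG$ is the disjoint union of $r$ copies of $G$, and $\overline{G}$ is the complement of $G$. A graph is $(H_1,\ldots,H_p)$-free if it has no induced subgraph isomorphic to any of $H_1,\ldots,H_p$. The induced subgraph relation is the quasi-order in which $H\leq G$ if and only if $H$ is isomorphic to an induced subgraph of $G$. A quasi-order $\leq$ on a set (or class) $X$ is a well-quasi-order if every infinite sequence $x_1,x_2,\ldots$ in $X$ contains a pair with $x_i\leq x_j$, $i<j$ (equivalently: no infinite strictly decreasing sequence and no infinite antichain). *)

theory Defs
  imports "Graph_Theory.Graph_Theory"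
begin

text \<open>A finite simple undirected graph is a \<^locale>\<open>pair_graph\<close>: a finite vertex set with a
  symmetric, irreflexive set of ordered pairs, so that an edge \<open>uv\<close> is represented by both
  \<open>(u, v)\<close> and \<open>(v, u)\<close>. The graph without vertices is included.\<close>

definition path_graph :: "nat \<Rightarrow> nat pair_pre_digraph" where
  "path_graph r = \<lparr> pverts = {..<r},
     parcs = {(i, j). i < r \<and> j < r \<and> (j = Suc i \<or> i = Suc j)} \<rparr>"

definition disjoint_union ::
    "'a pair_pre_digraph \<Rightarrow> 'b pair_pre_digraph \<Rightarrow> ('a + 'b) pair_pre_digraph" where
  "disjoint_union G H = \<lparr> pverts = pverts G <+> pverts H,
     parcs = {(Inl u, Inl v) |u v. (u, v) \<in> parcs G} \<union> {(Inr u, Inr v) |u v. (u, v) \<in> parcs H} \<rparr>"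

definition copies :: "nat \<Rightarrow> 'a pair_pre_digraph \<Rightarrow> (nat \<times> 'a) pair_pre_digraph" where
  "copies r G = \<lparr> pverts = {..<r} \<times> pverts G,
     parcs = {((i, u), (i, v)) |i u v. i < r \<and> (u, v) \<in> parcs G} \<rparr>"

definition complement :: "'a pair_pre_digraph \<Rightarrow> 'a pair_pre_digraph" where
  "complement G = \<lparr> pverts = pverts G,
     parcs = {(u, v). u \<in> pverts G \<and> v \<in> pverts G \<and> u \<noteq> v \<and> (u, v) \<notin> parcs G} \<rparr>"

definition induced_le :: "'a pair_pre_digraph \<Rightarrow> 'b pair_pre_digraph \<Rightarrow> bool" where
  "induced_le H G \<longleftrightarrow>
     (\<exists>K. induced_subgraph K (with_proj G) \<and> digraph_iso (with_proj H) K)"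

text \<open>The two forbidden graphs may have different vertex types, so the class is a binary notion
  rather than one indexed by a set of graphs. Every finite graph is isomorphic to one with vertices
  in \<^typ>\<open>nat\<close>, and \<^const>\<open>induced_le\<close> is invariant under isomorphism, so graphs on natural
  numbers represent all finite graphs.\<close>

definition free_class ::
    "'a pair_pre_digraph \<Rightarrow> 'b pair_pre_digraph \<Rightarrow> nat pair_pre_digraph set" where
  "free_class H\<^sub>1 H\<^sub>2 = {G. pair_graph G \<and> \<not> induced_le H\<^sub>1 G \<and> \<not> induced_le H\<^sub>2 G}"

text \<open>The relation is presupposed to be a quasi-order on \<open>X\<close>; this is not part of the definition,
  so that its negation really asserts that a bad sequence exists.\<close>

definition wqo_on :: "('a \<Rightarrow> 'a \<Rightarrow> bool) \<Rightarrow> 'a set \<Rightarrow> bool" where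
  "wqo_on le X \<longleftrightarrow>
     (\<forall>x :: nat \<Rightarrow> 'a. (\<forall>i. x i \<in> X) \<longrightarrow> (\<exists>i j. i < j \<and> le (x i) (x j)))"

lemma pair_graph_iff:
  "pair_graph G \<longleftrightarrow> finite (pverts G) \<and> parcs G \<subseteq> pverts G \<times> pverts G \<and>
     (\<forall>u v. (u, v) \<in> parcs G \<longrightarrow> u \<noteq> v \<and> (v, u) \<in> parcs G)"
proof
  assume "pair_graph G"
  then interpret pair_graph G .
  show "finite (pverts G) \<and> parcs G \<subseteq> pverts G \<times> pverts G \<and>
     (\<forall>u v. (u, v) \<in> parcs G \<longrightarrow> u \<noteq> v \<and> (v, u) \<in> parcs G)"
    using pair_finite_verts in_arcsD1 in_arcsD2 no_loops' arcs_symmetric by fastforce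
next
  assume a: "finite (pverts G) \<and> parcs G \<subseteq> pverts G \<times> pverts G \<and>
     (\<forall>u v. (u, v) \<in> parcs G \<longrightarrow> u \<noteq> v \<and> (v, u) \<in> parcs G)"
  then have "finite (parcs G)" by (meson finite_SigmaI finite_subset)
  with a show "pair_graph G"
    by unfold_locales (auto simp: symmetric_def sym_def arcs_ends_conv)
qed

lemma pair_graph_path_graph: "pair_graph (path_graph r)"
  by (auto simp: pair_graph_iff path_graph_def)

lemma pair_graph_disjoint_union:
  "pair_graph G \<Longrightarrow> pair_graph H \<Longrightarrow> pair_graph (disjoint_union G H)"
  by (auto simp: pair_graph_iff disjoint_union_def)

lemma pair_graph_copies: "pair_graph G \<Longrightarrow> pair_graph (copies r G)"
  by (auto simp: pair_graph_iff copies_def)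

lemma pair_graph_complement: "pair_graph G \<Longrightarrow> pair_graph (complement G)"
  by (auto simp: pair_graph_iff complement_def)

lemma induced_le_iff_embedding:
  assumes H: "pair_graph H" and G: "pair_graph G"
  shows "induced_le H G \<longleftrightarrow> (\<exists>f. inj_on f (pverts H) \<and> f ` pverts H \<subseteq> pverts G \<and>
     (\<forall>u \<in> pverts H. \<forall>v \<in> pverts H. (f u, f v) \<in> parcs G \<longleftrightarrow> (u, v) \<in> parcs H))"
    (is "_ \<longleftrightarrow> ?R")
proof
  assume "induced_le H G"
  then obtain K h where K: "induced_subgraph K (with_proj G)"
    and h: "pre_digraph.digraph_isomorphism (with_proj H) h" and Kh: "K = app_iso h (with_proj H)"
    by (auto simp: induced_le_def digraph_iso_def)
  let ?f = "iso_verts h"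
  have comp: "tail K = fst" "head K = snd" "verts K \<subseteq> pverts G"
    "arcs K = {e \<in> parcs G. fst e \<in> verts K \<and> snd e \<in> verts K}"
    using K by (auto simp: induced_subgraph_def subgraph_def compatible_def)
  have inj: "inj_on ?f (pverts H)"
    using h by (simp add: pre_digraph.digraph_isomorphism_def)
  have arc: "iso_arcs h (u, v) = (?f u, ?f v)" if "(u, v) \<in> parcs H" for u v
  proof -
    have "fst (iso_arcs h (u, v)) = ?f u" "snd (iso_arcs h (u, v)) = ?f v"
      using h that comp(1,2) Kh by (auto simp: pre_digraph.digraph_isomorphism_def)
    then show ?thesis by (simp add: prod_eq_iff)
  qed
  have wf: "parcs H \<subseteq> pverts H \<times> pverts H" using H by (simp add: pair_graph_iff)
  have vK: "verts K = ?f ` pverts H" and aK: "arcs K = iso_arcs h ` parcs H"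
    using Kh by auto
  have "(?f u, ?f v) \<in> parcs G \<longleftrightarrow> (u, v) \<in> parcs H" if uv: "u \<in> pverts H" "v \<in> pverts H" for u v
  proof
    assume "(?f u, ?f v) \<in> parcs G"
    then have "(?f u, ?f v) \<in> arcs K" using comp(4) vK uv by auto
    then obtain a b where ab: "(a, b) \<in> parcs H" "(?f u, ?f v) = iso_arcs h (a, b)"
      using aK by auto
    then have "?f u = ?f a" "?f v = ?f b" using arc by auto
    then show "(u, v) \<in> parcs H" using ab wf uv inj by (metis inj_onD mem_Sigma_iff subsetD)
  next
    assume "(u, v) \<in> parcs H"
    then have "(?f u, ?f v) \<in> arcs K" using arc aK by (metis image_eqI)
    then show "(?f u, ?f v) \<in> parcs G" using comp(4) by auto
  qed
  with inj comp(3) vK show ?R by blast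
next
  assume ?R
  then obtain f where inj: "inj_on f (pverts H)" and sub: "f ` pverts H \<subseteq> pverts G"
    and eq: "\<forall>u \<in> pverts H. \<forall>v \<in> pverts H. (f u, f v) \<in> parcs G \<longleftrightarrow> (u, v) \<in> parcs H" by blast
  have wf: "parcs H \<subseteq> pverts H \<times> pverts H" using H by (simp add: pair_graph_iff)
  interpret H: pair_graph H by fact
  interpret G: pair_graph G by fact
  let ?h = "\<lparr> iso_verts = f, iso_arcs = map_prod f f, iso_head = snd, iso_tail = fst \<rparr>"
  let ?K = "app_iso ?h (with_proj H)"
  have "inj_on (map_prod f f) (parcs H)"
    by (rule inj_on_subset[OF map_prod_inj_on[OF inj inj] wf])
  with inj have h: "pre_digraph.digraph_isomorphism (with_proj H) ?h"
    by (auto simp: pre_digraph.digraph_isomorphism_def H.wf_digraph)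
  have arcs: "map_prod f f ` parcs H = {e \<in> parcs G. fst e \<in> f ` pverts H \<and> snd e \<in> f ` pverts H}"
  proof (intro subset_antisym subsetI)
    fix e assume "e \<in> map_prod f f ` parcs H"
    then obtain u v where uv: "(u, v) \<in> parcs H" "e = (f u, f v)" by auto
    with wf have "u \<in> pverts H" "v \<in> pverts H" by auto
    with uv eq show "e \<in> {e \<in> parcs G. fst e \<in> f ` pverts H \<and> snd e \<in> f ` pverts H}" by simp
  next
    fix e assume "e \<in> {e \<in> parcs G. fst e \<in> f ` pverts H \<and> snd e \<in> f ` pverts H}"
    then obtain u v where uv: "u \<in> pverts H" "v \<in> pverts H" "e = (f u, f v)" "e \<in> parcs G"
      by (cases e) auto
    then have "(u, v) \<in> parcs H" using eq by blast
    with uv show "e \<in> map_prod f f ` parcs H" by (metis map_prod_imageI)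
  qed
  have "wf_digraph ?K" using h by (rule H.wf_digraphI_app_iso)
  moreover have "compatible (with_proj G) ?K" by (simp add: compatible_def)
  ultimately have "subgraph ?K (with_proj G)"
    using sub arcs by (auto simp: subgraph_def G.wf_digraph)
  then have "induced_subgraph ?K (with_proj G)"
    using arcs by (simp add: induced_subgraph_def)
  with h show "induced_le H G" by (auto simp: induced_le_def digraph_iso_def)
qed

lemma induced_le_refl: "pair_graph G \<Longrightarrow> induced_le G G"
  by (subst induced_le_iff_embedding) (auto intro!: exI[of _ id])

lemma induced_le_trans:
  assumes "pair_graph F" "pair_graph G" "pair_graph H" "induced_le F G" "induced_le G H"
  shows "induced_le F H"
proof -
  obtain f where f: "inj_on f (pverts F)" "f ` pverts F \<subseteq> pverts G"
    "\<forall>u \<in> pverts F. \<forall>v \<in> pverts F. (f u, f v) \<in> parcs G \<longleftrightarrow> (u, v) \<in> parcs F"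
    using assms induced_le_iff_embedding[of F G] by auto
  obtain g where g: "inj_on g (pverts G)" "g ` pverts G \<subseteq> pverts H"
    "\<forall>u \<in> pverts G. \<forall>v \<in> pverts G. (g u, g v) \<in> parcs H \<longleftrightarrow> (u, v) \<in> parcs G"
    using assms induced_le_iff_embedding[of G H] by auto
  have "inj_on (g \<circ> f) (pverts F)" using f g by (meson comp_inj_on inj_on_subset)
  moreover have "(g \<circ> f) ` pverts F \<subseteq> pverts H" using f g by (simp add: image_subset_iff)
  moreover have "\<forall>u \<in> pverts F. \<forall>v \<in> pverts F. ((g \<circ> f) u, (g \<circ> f) v) \<in> parcs H \<longleftrightarrow> (u, v) \<in> parcs F"
    using f g by (auto simp: image_subset_iff)
  ultimately show ?thesis using assms induced_le_iff_embedding[of F H] by blast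
qed

lemma induced_le_quasi_order:
  "reflp_on (free_class H\<^sub>1 H\<^sub>2) induced_le" "transp_on (free_class H\<^sub>1 H\<^sub>2) induced_le"
  by (auto simp: free_class_def intro!: reflp_onI transp_onI induced_le_refl
      intro: induced_le_trans)

end

theory Submission
  imports Defs
begin

text \<open>The antichain is obtained from cycles of length \<open>4m\<close>. Two consecutive vertices are put on one
  side, the next two on the other side, and so on around the cycle; then all pairs on the same side
  are complemented. The result consists of two cocktail party graphs joined by a perfect matching.
  Every vertex has at most one exceptional (cyclically consecutive) vertex on each side, which
  excludes both forbidden graphs. For large \<open>m\<close> an embedding must respect the sides, hence
  also the underlying cycles, and a cycle contains no shorter cycle.\<close>

definition side :: "nat \<Rightarrow> bool" where
  "side v \<longleftrightarrow> v mod 4 < 2"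

definition consec :: "nat \<Rightarrow> nat \<Rightarrow> nat \<Rightarrow> bool" where
  "consec n u v \<longleftrightarrow> v = Suc u mod n \<or> u = Suc v mod n"

text \<open>The inequality between truth values is an exclusive or: it complements adjacency in the
  cycle exactly on pairs from the same side.\<close>

definition twin_cocktail :: "nat \<Rightarrow> nat pair_pre_digraph" where
  "twin_cocktail m = \<lparr> pverts = {..<4 * m},
     parcs = {(u, v). u < 4 * m \<and> v < 4 * m \<and> u \<noteq> v \<and> (side u = side v) \<noteq> consec (4 * m) u v} \<rparr>"

lemma consec_sym: "consec n u v \<longleftrightarrow> consec n v u"
  by (auto simp: consec_def)

lemma pverts_twin_cocktail [simp]: "pverts (twin_cocktail m) = {..<4 * m}"
  by (simp add: twin_cocktail_def)

lemma parcs_twin_cocktail_iff: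
  assumes "u < 4 * m" "v < 4 * m" "u \<noteq> v"
  shows "(u, v) \<in> parcs (twin_cocktail m) \<longleftrightarrow> (side u = side v) \<noteq> consec (4 * m) u v"
  using assms by (simp add: twin_cocktail_def)

lemma pair_graph_twin_cocktail: "pair_graph (twin_cocktail m)"
  by (auto simp: pair_graph_iff twin_cocktail_def consec_sym)

lemma Suc_mod_inj:
  assumes "u < n" "v < n" "Suc u mod n = Suc v mod n"
  shows "u = v"
  using assms by (auto simp: mod_Suc split: if_splits)

text \<open>Since 4 divides the length of the cycle, the pattern of sides survives the wrap-around,
  and adding 2 exchanges the residues {0, 1} and {2, 3}.\<close>

lemma side_Suc_Suc_mod: "side (Suc (Suc v mod (4 * m)) mod (4 * m)) \<longleftrightarrow> \<not> side v"
proof -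
  have "Suc (Suc v mod (4 * m)) mod (4 * m) mod 4 = Suc (Suc v) mod 4"
    by (simp add: mod_mod_cancel mod_Suc_eq)
  moreover have "Suc (Suc v) mod 4 < 2 \<longleftrightarrow> \<not> v mod 4 < 2" by presburger
  ultimately show ?thesis by (simp only: side_def)
qed

text \<open>The predecessor and the successor of \<open>x\<close> are two steps apart, hence on
  opposite sides. All later arguments about exceptional vertices rest on this.\<close>

lemma consec_unique:
  assumes "y < 4 * m" "z < 4 * m" "consec (4 * m) x y" "consec (4 * m) x z" "side y = side z"
  shows "y = z"
proof -
  have "\<not> (y = Suc x mod (4 * m) \<and> x = Suc z mod (4 * m))"
    "\<not> (z = Suc x mod (4 * m) \<and> x = Suc y mod (4 * m))"
    using assms(5) side_Suc_Suc_mod[of z m] side_Suc_Suc_mod[of y m] by auto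
  with assms show ?thesis by (auto simp: consec_def dest: Suc_mod_inj)
qed

lemma twin_cocktail_gem_free:
  "\<not> induced_le (complement (disjoint_union (path_graph 1) (path_graph 4))) (twin_cocktail m)"
    (is "\<not> induced_le ?H ?G")
proof
  assume "induced_le ?H ?G"
  then obtain f where inj: "inj_on f (pverts ?H)" and sub: "f ` pverts ?H \<subseteq> pverts ?G"
    and adj: "\<forall>u \<in> pverts ?H. \<forall>v \<in> pverts ?H. (f u, f v) \<in> parcs ?G \<longleftrightarrow> (u, v) \<in> parcs ?H"
    by (auto simp: induced_le_iff_embedding pair_graph_complement pair_graph_disjoint_union
        pair_graph_path_graph pair_graph_twin_cocktail)
  have V: "pverts ?H = {Inl 0, Inr 0, Inr 1, Inr 2, Inr 3}"
    by (auto simp: complement_def disjoint_union_def path_graph_def)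
  \<comment> \<open>The complement of the path 0, 1, 2, 3 is the path 1, 3, 0, 2. So
    \<open>p\<close>, \<open>q\<close>, \<open>r\<close>, \<open>s\<close> is an induced path, and
    \<open>x\<close> is adjacent to all of it.\<close>
  define x p q r s where xpqrs: "x = f (Inl 0)" "p = f (Inr 1)" "q = f (Inr 3)" "r = f (Inr 0)" "s = f (Inr 2)"
  have lt: "x < 4 * m" "p < 4 * m" "q < 4 * m" "r < 4 * m" "s < 4 * m"
    using sub unfolding V xpqrs by auto
  have dist: "distinct [x, p, q, r, s]"
    using inj unfolding V xpqrs by (auto simp: inj_on_def)
  have E: "(x, p) \<in> parcs ?G" "(x, q) \<in> parcs ?G" "(x, r) \<in> parcs ?G" "(x, s) \<in> parcs ?G" "(p, q) \<in> parcs ?G" "(q, r) \<in> parcs ?G" "(r, s) \<in> parcs ?G"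
      "(p, r) \<notin> parcs ?G" "(p, s) \<notin> parcs ?G" "(q, s) \<notin> parcs ?G"
    unfolding xpqrs by (simp_all add: adj V del: One_nat_def)
      (auto simp: complement_def disjoint_union_def path_graph_def)
  let ?A = "\<lambda>u v. (side u = side v) \<noteq> consec (4 * m) u v"
  have A: "?A x p" "?A x q" "?A x r" "?A x s"
      "?A p q" "?A q r" "?A r s" "\<not> ?A p r" "\<not> ?A p s" "\<not> ?A q s"
    using E lt dist by (simp_all add: parcs_twin_cocktail_iff)
  \<comment> \<open>A triangle lies within one side: otherwise one of its vertices is alone on its
    side and consecutive to the other two, which share a side.\<close>
  have same: "side u = side x \<and> side v = side x"
    if uv: "?A x u" "?A x v" "?A u v" "u \<noteq> v" "u \<noteq> x" "v \<noteq> x" "u < 4 * m" "v < 4 * m" for u v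
  proof -
    have "\<not> (consec (4 * m) x u \<and> consec (4 * m) x v \<and> side u = side v)"
      "\<not> (consec (4 * m) u x \<and> consec (4 * m) u v \<and> side x = side v)"
      "\<not> (consec (4 * m) v x \<and> consec (4 * m) v u \<and> side x = side u)"
      using consec_unique[of u m v x] consec_unique[of x m v u] consec_unique[of x m u v] uv(4-8) lt(1)
      by metis+
    moreover have "consec (4 * m) u x = consec (4 * m) x u" "consec (4 * m) v x = consec (4 * m) x v"
      "consec (4 * m) v u = consec (4 * m) u v"
      by (rule consec_sym)+
    ultimately show ?thesis using uv(1-3) by argo
  qed
  have "p \<noteq> q" "r \<noteq> s" "p \<noteq> x" "q \<noteq> x" "r \<noteq> x" "s \<noteq> x" using dist by auto
  \<comment> \<open>The triangles \<open>x p q\<close> and \<open>x r s\<close> put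
    \<open>p\<close>, \<open>r\<close>, \<open>s\<close> on one side, where \<open>p\<close> would
    have two non-neighbours.\<close>
  then have "side p = side x" "side r = side x" "side s = side x"
    using same[OF A(1,2,5)] same[OF A(3,4,7)] lt by blast+
  then have "consec (4 * m) p r" "consec (4 * m) p s" "side r = side s"
    using A(8,9) by blast+
  then show False using consec_unique[of r m s p] lt dist by auto
qed

lemma twin_cocktail_P1_2P2_free:
  "\<not> induced_le (disjoint_union (path_graph 1) (copies 2 (path_graph 2))) (twin_cocktail m)"
    (is "\<not> induced_le ?H ?G")
proof
  assume "induced_le ?H ?G"
  then obtain f where inj: "inj_on f (pverts ?H)" and sub: "f ` pverts ?H \<subseteq> pverts ?G"
    and adj: "\<forall>u \<in> pverts ?H. \<forall>v \<in> pverts ?H. (f u, f v) \<in> parcs ?G \<longleftrightarrow> (u, v) \<in> parcs ?H"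
    by (auto simp: induced_le_iff_embedding pair_graph_copies pair_graph_disjoint_union
        pair_graph_path_graph pair_graph_twin_cocktail)
  have V: "pverts ?H = {Inl 0, Inr (0, 0), Inr (0, 1), Inr (1, 0), Inr (1, 1)}"
    by (auto simp: copies_def disjoint_union_def path_graph_def)
  define x p q r s where xpqrs: "x = f (Inl 0)"
    "p = f (Inr (0, 0))" "q = f (Inr (0, 1))" "r = f (Inr (1, 0))" "s = f (Inr (1, 1))"
  have lt: "x < 4 * m" "p < 4 * m" "q < 4 * m" "r < 4 * m" "s < 4 * m"
    using sub unfolding V xpqrs by auto
  have dist: "distinct [x, p, q, r, s]"
    using inj unfolding V xpqrs by (auto simp: inj_on_def)
  have E: "(x, p) \<notin> parcs ?G" "(x, q) \<notin> parcs ?G" "(x, r) \<notin> parcs ?G" "(x, s) \<notin> parcs ?G" "(p, r) \<notin> parcs ?G" "(p, s) \<notin> parcs ?G" "(q, r) \<notin> parcs ?G" "(q, s) \<notin> parcs ?G"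
    unfolding xpqrs by (simp_all add: adj V del: One_nat_def)
      (auto simp: copies_def disjoint_union_def path_graph_def)
  let ?A = "\<lambda>u v. (side u = side v) \<noteq> consec (4 * m) u v"
  have A: "\<not> ?A x p" "\<not> ?A x q" "\<not> ?A x r" "\<not> ?A x s"
      "\<not> ?A p r" "\<not> ?A p s" "\<not> ?A q r" "\<not> ?A q s"
    using E lt dist by (simp_all add: parcs_twin_cocktail_iff)
  \<comment> \<open>Non-neighbours on the same side are consecutive, so each vertex has at most
    one.\<close>
  have not_same: "\<not> (side u = side v \<and> side u = side w)"
    if "\<not> ?A u v" "\<not> ?A u w" "v \<noteq> w" "v < 4 * m" "w < 4 * m" for u v w
    using that consec_unique[of v m w u] by auto
  have A': "\<not> ?A r p" "\<not> ?A r q" "\<not> ?A s p" "\<not> ?A s q"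
    using A(5-8) by (auto simp: consec_sym)
  have neq: "p \<noteq> q" "p \<noteq> r" "p \<noteq> s" "q \<noteq> r" "q \<noteq> s" "r \<noteq> s"
    using dist by auto
  \<comment> \<open>At most one of \<open>p\<close>, \<open>q\<close>, \<open>r\<close>,
    \<open>s\<close> is on the side of \<open>x\<close>. The other three or more contain both ends
    of one edge and an end of the other edge; this end has two non-neighbours on its own
    side.\<close>
  note not_same[OF A(1) A(2) neq(1) lt(2,3)] not_same[OF A(1) A(3) neq(2) lt(2,4)]
    not_same[OF A(1) A(4) neq(3) lt(2,5)] not_same[OF A(2) A(3) neq(4) lt(3,4)]
    not_same[OF A(2) A(4) neq(5) lt(3,5)] not_same[OF A(3) A(4) neq(6) lt(4,5)]
    not_same[OF A(5) A(6) neq(6) lt(4,5)] not_same[OF A(7) A(8) neq(6) lt(4,5)]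
    not_same[OF A'(1) A'(2) neq(1) lt(2,3)] not_same[OF A'(3) A'(4) neq(1) lt(2,3)]
  then show False by argo
qed

lemma many_on_side_avoiding:
  assumes "finite B" "card B + k \<le> m"
  obtains W where "W \<subseteq> {v. v < 4 * m \<and> side v = s} - B" "card W = k"
proof -
  \<comment> \<open>One vertex from each block of four: only half of the side, but enough for the
    counts below.\<close>
  define g :: "nat \<Rightarrow> nat" where "g i = 4 * i + (if s then 0 else 2)" for i
  have "inj_on g {..<m}" by (auto simp: g_def inj_on_def)
  then have "card (g ` {..<m}) = m" by (simp add: card_image)
  then have "k \<le> card (g ` {..<m} - B)"
    using diff_card_le_card_Diff[OF assms(1), of "g ` {..<m}"] assms(2) by linarith
  then obtain W where W: "W \<subseteq> g ` {..<m} - B" "card W = k"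
    by (meson obtain_subset_with_card_n)
  moreover have "g ` {..<m} \<subseteq> {v. v < 4 * m \<and> side v = s}"
    by (auto simp: g_def side_def) presburger
  ultimately have "W \<subseteq> {v. v < 4 * m \<and> side v = s} - B"
    by (meson Diff_mono order_refl order_trans)
  then show thesis using W(2) by (rule that)
qed

text \<open>By uniqueness, \<open>side\<close> is injective on the vertices consecutive to
  \<open>v\<close>, and it takes only two values.\<close>

lemma consec_covered_by_two:
  obtains B where "finite B" "card B \<le> 2" "\<And>w. w < 4 * m \<Longrightarrow> consec (4 * m) v w \<Longrightarrow> w \<in> B"
proof -
  define B where "B = {w. w < 4 * m \<and> consec (4 * m) v w}"
  have "inj_on side B" using consec_unique by (auto simp: B_def inj_on_def)
  then have "card B \<le> card (UNIV :: bool set)" by (intro card_inj_on_le) auto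
  with that show thesis by (auto simp: B_def)
qed

lemma twin_cocktail_antichain:
  assumes "9 \<le> m" "m < l"
  shows "\<not> induced_le (twin_cocktail m) (twin_cocktail l)"
proof
  assume "induced_le (twin_cocktail m) (twin_cocktail l)"
  then obtain f where inj: "inj_on f {..<4 * m}" and sub: "f ` {..<4 * m} \<subseteq> {..<4 * l}"
    and emb: "\<forall>u < 4 * m. \<forall>v < 4 * m.
      (f u, f v) \<in> parcs (twin_cocktail l) \<longleftrightarrow> (u, v) \<in> parcs (twin_cocktail m)"
    by (auto simp: induced_le_iff_embedding pair_graph_twin_cocktail)
  have lt: "f u < 4 * l" if "u < 4 * m" for u using sub that by auto
  have neq: "f u \<noteq> f v" if "u < 4 * m" "v < 4 * m" "u \<noteq> v" for u v
    using inj that by (auto simp: inj_on_def)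
  have adj: "((side (f u) = side (f v)) \<noteq> consec (4 * l) (f u) (f v)) \<longleftrightarrow>
      ((side u = side v) \<noteq> consec (4 * m) u v)" if "u < 4 * m" "v < 4 * m" "u \<noteq> v" for u v
    using emb that lt neq by (metis parcs_twin_cocktail_iff)
  \<comment> \<open>Suppose \<open>f u\<close> and \<open>f v\<close> are separated. The image of a
    common neighbour \<open>w\<close> lies opposite exactly one of them and is consecutive to it, so
    it is determined by its side. Hence three common neighbours are too many.\<close>
  have same: "side (f u) = side (f v)" if uv: "u < 4 * m" "v < 4 * m" "side u = side v" for u v
  proof (rule ccontr)
    assume diff: "side (f u) \<noteq> side (f v)"
    obtain B where B: "finite B" "card B \<le> 2" "\<And>w. w < 4 * m \<Longrightarrow> consec (4 * m) u w \<Longrightarrow> w \<in> B"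
      using consec_covered_by_two[of m u] by blast
    obtain C where C: "finite C" "card C \<le> 2" "\<And>w. w < 4 * m \<Longrightarrow> consec (4 * m) v w \<Longrightarrow> w \<in> C"
      using consec_covered_by_two[of m v] by blast
    \<comment> \<open>The bound 9 on \<open>m\<close> comes from here: two exceptional vertices for
      each of \<open>u\<close> and \<open>v\<close>, these two themselves, and three vertices to
      choose.\<close>
    have "card (B \<union> C \<union> {u, v}) \<le> card B + card C + card {u, v}"
      by (meson card_Un_le add_le_mono1 order_trans)
    also have "\<dots> \<le> 6" using B(2) C(2) card_insert_le_m1[of 2 "{v}" u] by simp
    finally have "card (B \<union> C \<union> {u, v}) + 3 \<le> m" using assms(1) by linarith
    then obtain W where W: "W \<subseteq> {w. w < 4 * m \<and> side w = side u} - (B \<union> C \<union> {u, v})" "card W = 3"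
      using many_on_side_avoiding[of "B \<union> C \<union> {u, v}" 3 m "side u"] B(1) C(1) by auto
    have near: "(side (f u) = side (f w)) \<noteq> consec (4 * l) (f u) (f w)"
      "(side (f v) = side (f w)) \<noteq> consec (4 * l) (f v) (f w)" if "w \<in> W" for w
      using adj[of u w] adj[of v w] W(1) that uv B(3)[of w] C(3)[of w] by auto
    have "inj_on (side \<circ> f) W"
    proof (rule inj_onI)
      fix w w' assume ww: "w \<in> W" "w' \<in> W" "(side \<circ> f) w = (side \<circ> f) w'"
      then have "w < 4 * m" "w' < 4 * m" using W(1) by auto
      moreover have "f w = f w'"
        using near[OF ww(1)] near[OF ww(2)] diff ww(3) lt calculation
        by (metis consec_unique comp_apply)
      ultimately show "w = w'" using neq by blast
    qed
    then have "card W \<le> card (UNIV :: bool set)" by (intro card_inj_on_le) auto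
    with W(2) show False by simp
  qed
  have side: "side (f u) = side (f v) \<longleftrightarrow> side u = side v" if uv: "u < 4 * m" "v < 4 * m" for u v
  proof (cases "side u = side v")
    case True
    then show ?thesis using same[OF uv] by simp
  next
    case False
    have "side (f u) \<noteq> side (f v)"
    proof
      \<comment> \<open>Two non-neighbours of \<open>u\<close> on the side of \<open>v\<close> would
        both be mapped to the side of \<open>f u\<close>, where \<open>f u\<close> has at most one
        non-neighbour.\<close>
      assume eq: "side (f u) = side (f v)"
      obtain B where B: "finite B" "card B \<le> 2" "\<And>w. w < 4 * m \<Longrightarrow> consec (4 * m) u w \<Longrightarrow> w \<in> B"
        using consec_covered_by_two[of m u] by blast
      obtain W where W: "W \<subseteq> {w. w < 4 * m \<and> side w = side v} - B" "card W = 2"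
        using many_on_side_avoiding[of B 2 m "side v"] B(1,2) assms(1) by auto
      obtain w w' where ww: "W = {w, w'}" "w \<noteq> w'"
        using W(2) by (meson card_2_iff)
      then have wW: "w < 4 * m" "w' < 4 * m" "side w = side v" "side w' = side v"
        "\<not> consec (4 * m) u w" "\<not> consec (4 * m) u w'"
        using W(1) B(3) by auto
      have sides: "side (f w) = side (f u)" "side (f w') = side (f u)"
        using same[OF wW(1) uv(2) wW(3)] same[OF wW(2) uv(2) wW(4)] eq by auto
      then have "consec (4 * l) (f u) (f w)" "consec (4 * l) (f u) (f w')"
        using adj[of u w] adj[of u w'] wW uv(1) False by metis+
      then show False
        using consec_unique[of "f w" l "f w'" "f u"] lt neq wW ww(2) sides by auto
    qed
    with False show ?thesis by simp
  qed
  have consec: "consec (4 * l) (f u) (f v)" if "u < 4 * m" "v < 4 * m" "u \<noteq> v" "consec (4 * m) u v" for u v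
    using adj[of u v] side[of u v] that by auto
  let ?S = "f ` {..<4 * m}"
  \<comment> \<open>Both cyclic neighbours of \<open>u\<close> go to distinct vertices consecutive
    to \<open>f u\<close>. They cannot both have \<open>f u\<close> as their successor, so one of
    them is the successor of \<open>f u\<close>.\<close>
  have closed: "Suc w mod (4 * l) \<in> ?S" if w: "w \<in> ?S" for w
  proof -
    obtain u where u: "u < 4 * m" "w = f u" using w by auto
    define y where "y = Suc u mod (4 * m)"
    define z where "z = (if u = 0 then 4 * m - 1 else u - 1)"
    have yz: "y < 4 * m" "z < 4 * m" "y \<noteq> u" "z \<noteq> u" "y \<noteq> z" "u = Suc z mod (4 * m)"
      using assms(1) u(1) by (auto simp: y_def z_def mod_Suc)
    then have "consec (4 * m) u y" "consec (4 * m) u z"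
      by (auto simp: consec_def y_def)
    then have "consec (4 * l) w (f y)" "consec (4 * l) w (f z)"
      using consec u yz by auto
    then have "f y = Suc w mod (4 * l) \<or> f z = Suc w mod (4 * l)"
      using Suc_mod_inj[of "f y" "4 * l" "f z"] lt neq yz by (auto simp: consec_def)
    then show ?thesis using yz by (metis imageI lessThan_iff)
  qed
  have shift: "(f 0 + k) mod (4 * l) \<in> ?S" for k
  proof (induction k)
    case 0
    show ?case using lt[of 0] assms(1) by simp
  next
    case (Suc k)
    then show ?case using closed by (metis add_Suc_right mod_Suc_eq)
  qed
  have "{..<4 * l} \<subseteq> ?S"
  proof
    fix y assume "y \<in> {..<4 * l}"
    moreover have "f 0 < 4 * l" using lt assms(1) by simp
    \<comment> \<open>Adding a full turn \<open>4 * l\<close> keeps the subtraction of natural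
      numbers from truncating.\<close>
    ultimately have "(f 0 + (y + 4 * l - f 0)) mod (4 * l) = y" by simp
    then show "y \<in> ?S" using shift by metis
  qed
  then have "card {..<4 * l} \<le> card ?S" by (intro card_mono) auto
  also have "\<dots> \<le> 4 * m" using card_image_le[of "{..<4 * m}" f] by simp
  finally show False using assms(2) by simp
qed

theorem theorem4:
  shows "\<not> wqo_on induced_le
    (free_class (complement (disjoint_union (path_graph 1) (path_graph 4)))
       (disjoint_union (path_graph 1) (copies 2 (path_graph 2))))"
proof
  \<comment> \<open>The shift by 9 meets the lower bound in
    \<open>twin_cocktail_antichain\<close>.\<close>
  let ?x = "\<lambda>i. twin_cocktail (i + 9)"
  let ?X = "free_class (complement (disjoint_union (path_graph 1) (path_graph 4)))
    (disjoint_union (path_graph 1) (copies 2 (path_graph 2)))"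
  assume wqo: "wqo_on induced_le ?X"
  have "?x i \<in> ?X" for i
    using pair_graph_twin_cocktail twin_cocktail_gem_free twin_cocktail_P1_2P2_free
    unfolding free_class_def by blast
  then have "\<exists>i j. i < j \<and> induced_le (?x i) (?x j)"
    using wqo[unfolded wqo_on_def, THEN spec, of ?x] by simp
  then obtain i j where "i < j" "induced_le (?x i) (?x j)" by (elim exE conjE)
  then show False using twin_cocktail_antichain[of "i + 9" "j + 9"] by simp
qed

end
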